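(* Let $K$ be a field, $S=K[x_1,\dots,x_n]$, $d\ge 2$ and $\mathbf t=(t_1,\dots,t_{d-1})\in\mathbb Z_{\ge 0}^{d-1}$. Let $I\subset S$ be a $\mathbf t$-spread strongly stable ideal. Then there exists a unique $\mathbf t$-spread lex ideal $I^{\mathbf t,\mathrm{lex}}\subset S$ such that $f_{\mathbf t}(I)=f_{\mathbf t}(I^{\mathbf t,\mathrm{lex}})$.
   Context: A monomial $u=x_{j_1}\cdots x_{j_\ell}$ of $S$ with $1\le j_1\le\cdots\le j_\ell\le n$ and degree $\ell\le d$ is $\mathbf t$-spread if $j_{i+1}-j_i\ge t_i$ for $i=1,\dots,\ell-1$ (so all $\mathbf t$-spread monomials have degree at most $d$). $M_{n,\ell,\mathbf t}$ is the set of all $\mathbf t$-spread monomials of degree $\ell$ in $S$. A $\mathbf t$-spread ideal is a monomial ideal generated by $\mathbf t$-spread monomials. For a monomial ideal $I$, $[I_\ell]_{\mathbf t}$ is the set of all $\mathbf t$-spread monomials of degree $\ell$ in $I$. The $f_{\mathbf t}$-vector of $I$ is $f_{\mathbf t}(I)=(f_{\mathbf t,-1}(I),f_{\mathbf t,0}(I),\dots,f_{\mathbf t,d-1}(I))$ with $f_{\mathbf t,\ell-1}(I)=|M_{n,\ell,\mathbf t}|-|[I_\ell]_{\mathbf t}|$ for $0\le \ell\le d$. A set $L\subseteq M_{n,\ell,\mathbf t}$ is a $\mathbf t$-spread strongly stable set if for all $u\in L$ and all $j<i$ such that $x_i$ divides $u$ and $x_j(u/x_i)$ is $\mathbf t$-spread,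 one has $x_j(u/x_i)\in L$. It is a $\mathbf t$-spread lex set if for all $u\in L$ and $v\in M_{n,\ell,\mathbf t}$ with $v\ge_{\mathrm{lex}}u$ one has $v\in L$, where $\ge_{\mathrm{lex}}$ is the lexicographic order induced by $x_1>\dots>x_n$. The empty set is both. A $\mathbf t$-spread ideal $I$ is a $\mathbf t$-spread strongly stable (resp. lex) ideal if $[I_\ell]_{\mathbf t}$ is a $\mathbf t$-spread strongly stable (resp. lex) set for all $\ell$. *)

theory Defs
  imports "HOL-Library.Multiset" "HOL-Library.Poly_Mapping" "HOL-Algebra.Ideal"
begin

text \<open>
  A monomial \<open>x\<^bsub>j\<^sub>1\<^esub> \<cdots> x\<^bsub>j\<^sub>l\<^esub>\<close> is represented by the multiset \<open>{#j\<^sub>1, \<dots>, j\<^sub>l#}\<close> of its variable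
  indices, so that multiplication of monomials is addition of multisets and the degree is
  \<^const>\<open>size\<close>. A polynomial is a finitely supported map from monomials to coefficients, with the
  convolution product of \<^theory>\<open>HOL-Library.Poly_Mapping\<close>. The ring \<open>K[x\<^sub>1, \<dots>, x\<^sub>n]\<close> consists of
  the polynomials in which only variables with index in \<open>{1..n}\<close> occur.
\<close>

definition poly_ring :: "nat \<Rightarrow> (nat multiset \<Rightarrow>\<^sub>0 'k::field) ring" where
  "poly_ring n = \<lparr>carrier = {p. \<forall>u\<in>Poly_Mapping.keys p. set_mset u \<subseteq> {1..n}},
     monoid.mult = (*), one = 1, zero = 0, add = (+)\<rparr>"

definition monomial :: "nat multiset \<Rightarrow> (nat multiset \<Rightarrow>\<^sub>0 'k::field)" where
  "monomial u = Poly_Mapping.single u 1"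

lemma poly_ring_cring: "cring (poly_ring n :: (nat multiset \<Rightarrow>\<^sub>0 'k::field) ring)"
proof (rule cringI)
  let ?R = "poly_ring n :: (nat multiset \<Rightarrow>\<^sub>0 'k) ring"
  have carrier: "p \<in> carrier ?R \<longleftrightarrow> (\<forall>u\<in>Poly_Mapping.keys p. set_mset u \<subseteq> {1..n})" for p
    by (simp add: poly_ring_def)
  have add: "p + q \<in> carrier ?R" if "p \<in> carrier ?R" "q \<in> carrier ?R" for p q
    using that Poly_Mapping.keys_add[of p q] unfolding carrier by blast
  have mult: "p * q \<in> carrier ?R" if "p \<in> carrier ?R" "q \<in> carrier ?R" for p q
    unfolding carrier
  proof
    fix w assume "w \<in> Poly_Mapping.keys (p * q)"
    then obtain u v where "u \<in> Poly_Mapping.keys p" "v \<in> Poly_Mapping.keys q" "w = u + v"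
      using Poly_Mapping.keys_mult[of p q] by blast
    then show "set_mset w \<subseteq> {1..n}"
      using that unfolding carrier by simp
  qed
  have inv: "- p \<in> carrier ?R" if "p \<in> carrier ?R" for p
    using that by (simp add: carrier)
  have ops: "p \<oplus>\<^bsub>?R\<^esub> q = p + q" "p \<otimes>\<^bsub>?R\<^esub> q = p * q" "\<zero>\<^bsub>?R\<^esub> = 0" "\<one>\<^bsub>?R\<^esub> = 1" for p q
    by (simp_all add: poly_ring_def)
  have zero: "0 \<in> carrier ?R" and one: "1 \<in> carrier ?R"
    by (simp_all add: carrier)
  show "abelian_group ?R"
  proof (rule abelian_groupI)
    fix p assume "p \<in> carrier ?R"
    then show "\<exists>q\<in>carrier ?R. q \<oplus>\<^bsub>?R\<^esub> p = \<zero>\<^bsub>?R\<^esub>"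
      using inv[of p] by (intro bexI[of _ "- p"]) (simp_all add: ops)
  qed (simp_all only: ops add zero add.assoc add.commute add.left_commute add_0_left add_0_right)
  show "comm_monoid ?R"
    by (rule comm_monoidI)
      (simp_all only: ops mult one mult.assoc mult.commute mult.left_commute mult_1_left mult_1_right)
  show "(p \<oplus>\<^bsub>?R\<^esub> q) \<otimes>\<^bsub>?R\<^esub> r = p \<otimes>\<^bsub>?R\<^esub> r \<oplus>\<^bsub>?R\<^esub> q \<otimes>\<^bsub>?R\<^esub> r" for p q r
    by (simp only: ops distrib_right)
qed

text \<open>
  The vector \<open>\<^bold>t = (t\<^sub>1, \<dots>, t\<^bsub>d-1\<^esub>)\<close> is a list of length \<open>d - 1\<close>; list positions count from 0, so
  \<open>t\<^sub>i\<close> is \<open>t ! (i - 1)\<close>, and likewise for the sorted list of indices \<open>j\<^sub>1 \<le> \<dots> \<le> j\<^sub>l\<close>.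
\<close>

definition t_spread :: "nat \<Rightarrow> nat \<Rightarrow> nat list \<Rightarrow> nat multiset \<Rightarrow> bool" where
  "t_spread n d t u \<longleftrightarrow> set_mset u \<subseteq> {1..n} \<and> size u \<le> d \<and>
     (let js = sorted_list_of_multiset u
      in \<forall>i. Suc i < length js \<longrightarrow> js ! Suc i \<ge> js ! i + t ! i)"

definition t_spread_monomials :: "nat \<Rightarrow> nat \<Rightarrow> nat list \<Rightarrow> nat \<Rightarrow> nat multiset set" where
  "t_spread_monomials n d t l = {u. t_spread n d t u \<and> size u = l}"

definition t_spread_ideal ::
    "nat \<Rightarrow> nat \<Rightarrow> nat list \<Rightarrow> (nat multiset \<Rightarrow>\<^sub>0 'k::field) set \<Rightarrow> bool" where
  "t_spread_ideal n d t I \<longleftrightarrow>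
     (\<exists>G. G \<subseteq> {u. t_spread n d t u} \<and> I = genideal (poly_ring n) (monomial ` G))"

definition t_spread_part ::
    "nat \<Rightarrow> nat \<Rightarrow> nat list \<Rightarrow> (nat multiset \<Rightarrow>\<^sub>0 'k::field) set \<Rightarrow> nat \<Rightarrow> nat multiset set" where
  "t_spread_part n d t I l = {u \<in> t_spread_monomials n d t l. monomial u \<in> I}"

text \<open>The entry at list position \<open>l\<close>, for \<open>0 \<le> l \<le> d\<close>, is \<open>f\<^bsub>\<^bold>t,l-1\<^esub>(I)\<close>.\<close>

definition f_vector ::
    "nat \<Rightarrow> nat \<Rightarrow> nat list \<Rightarrow> (nat multiset \<Rightarrow>\<^sub>0 'k::field) set \<Rightarrow> int list" where
  "f_vector n d t I =
     map (\<lambda>l. int (card (t_spread_monomials n d t l)) - int (card (t_spread_part n d t I l)))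
       [0..<Suc d]"

definition t_spread_strongly_stable_set ::
    "nat \<Rightarrow> nat \<Rightarrow> nat list \<Rightarrow> nat \<Rightarrow> nat multiset set \<Rightarrow> bool" where
  "t_spread_strongly_stable_set n d t l L \<longleftrightarrow> L \<subseteq> t_spread_monomials n d t l \<and>
     (\<forall>u\<in>L. \<forall>i j. j < i \<and> i \<in># u \<and> t_spread n d t (add_mset j (u - {#i#}))
        \<longrightarrow> add_mset j (u - {#i#}) \<in> L)"

text \<open>
  Lexicographic order with \<open>x\<^sub>1 > \<dots> > x\<^sub>n\<close>: at the smallest index where the exponents differ,
  the larger monomial has the larger exponent.
\<close>

definition lex_ge :: "nat multiset \<Rightarrow> nat multiset \<Rightarrow> bool" where
  "lex_ge v u \<longleftrightarrow> v = u \<or> (\<exists>k. count v k > count u k \<and> (\<forall>j<k. count v j = count u j))"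

definition t_spread_lex_set ::
    "nat \<Rightarrow> nat \<Rightarrow> nat list \<Rightarrow> nat \<Rightarrow> nat multiset set \<Rightarrow> bool" where
  "t_spread_lex_set n d t l L \<longleftrightarrow> L \<subseteq> t_spread_monomials n d t l \<and>
     (\<forall>u\<in>L. \<forall>v\<in>t_spread_monomials n d t l. lex_ge v u \<longrightarrow> v \<in> L)"

definition t_spread_strongly_stable_ideal ::
    "nat \<Rightarrow> nat \<Rightarrow> nat list \<Rightarrow> (nat multiset \<Rightarrow>\<^sub>0 'k::field) set \<Rightarrow> bool" where
  "t_spread_strongly_stable_ideal n d t I \<longleftrightarrow> t_spread_ideal n d t I \<and>
     (\<forall>l. t_spread_strongly_stable_set n d t l (t_spread_part n d t I l))"

definition t_spread_lex_ideal ::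
    "nat \<Rightarrow> nat \<Rightarrow> nat list \<Rightarrow> (nat multiset \<Rightarrow>\<^sub>0 'k::field) set \<Rightarrow> bool" where
  "t_spread_lex_ideal n d t I \<longleftrightarrow> t_spread_ideal n d t I \<and>
     (\<forall>l. t_spread_lex_set n d t l (t_spread_part n d t I l))"

end

theory Submission imports Defs begin

text \<open>
  Strong stability means that the exponent sequences of the monomials in \<open>[I\<^sub>l]\<close> are closed under
  componentwise lowering. So a spread multiple of degree \<open>l + 1\<close> of an element of \<open>[I\<^sub>l]\<close> already
  has its \<open>l\<close> smallest indices in \<open>[I\<^sub>l]\<close>, and the number of such multiples is determined by the numbers
  of elements of \<open>[I\<^sub>l]\<close> with largest index at most \<open>q\<close>. As in Bayer's argument for \<open>\<^bold>t = 0\<close>, a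
  lex set minimises these numbers among stable sets of its size: split a stable set \<open>D\<close>
  according to whether the largest index equals the bound \<open>m\<close>, replace both pieces by lex sets of
  the same size, and compare the result with the lex set \<open>L\<close>. Hence the lex sets of the sizes
  \<open>|[I\<^sub>l]|\<close> are closed under taking multiples and form an ideal. It is unique because lex sets
  of a fixed degree form a chain.
\<close>

section \<open>Lexicographic and stable sets of spread lists\<close>

text \<open>
  The lists are descending, and \<open>s i\<close> is the required gap between the \<open>i\<close>-th and the
  \<open>(i + 1)\<close>-th smallest entry. The truncated subtraction is harmless:
  a nonempty list has no bound 0, and the empty list has no gap to respect.
\<close>

primrec spread_lists :: "(nat \<Rightarrow> nat) \<Rightarrow> nat \<Rightarrow> nat \<Rightarrow> nat list set" where
  "spread_lists s 0 m = {[]}"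
| "spread_lists s (Suc l) m = {x # b | x b. 1 \<le> x \<and> x \<le> m \<and> b \<in> spread_lists s l (x - s l)}"

lemma length_spread_lists: "w \<in> spread_lists s l m \<Longrightarrow> length w = l"
  by (induction l arbitrary: w m) auto

lemma spread_lists_mono: "w \<in> spread_lists s l m \<Longrightarrow> m \<le> m' \<Longrightarrow> w \<in> spread_lists s l m'"
  by (cases l) auto

lemma finite_spread_lists: "finite (spread_lists s l m)"
proof (induction l arbitrary: m)
  case (Suc l)
  have "spread_lists s (Suc l) m = (\<Union>x\<in>{1..m}. (#) x ` spread_lists s l (x - s l))"
    by auto
  then show ?case using Suc by simp
qed simp

text \<open>
  As the lists are descending, tails are compared before heads. The smaller list is the larger
  monomial.
\<close>

fun lex_le :: "nat list \<Rightarrow> nat list \<Rightarrow> bool" where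
  "lex_le (x # a) (y # b) \<longleftrightarrow> (if a = b then x \<le> y else lex_le a b)"
| "lex_le a b \<longleftrightarrow> a = b"

lemma lex_le_refl: "lex_le a a"
  by (induction a) auto

lemma lex_le_total: "length a = length b \<Longrightarrow> lex_le a b \<or> lex_le b a"
  by (induction a b rule: list_induct2) auto

lemma lex_le_antisym: "length a = length b \<Longrightarrow> lex_le a b \<Longrightarrow> lex_le b a \<Longrightarrow> a = b"
  by (induction a b rule: list_induct2) (auto split: if_splits)

lemma lex_le_trans:
  "length a = length b \<Longrightarrow> length b = length c \<Longrightarrow> lex_le a b \<Longrightarrow> lex_le b c \<Longrightarrow> lex_le a c"
proof (induction a b c rule: list_induct3)
  case (Cons x xs y ys z zs)
  then show ?case
    using lex_le_antisym[of xs ys] by (auto split: if_splits)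
qed simp

lemma lex_le_if_componentwise: "list_all2 (\<le>) a b \<Longrightarrow> lex_le a b"
  by (induction rule: list_all2_induct) auto

lemma lex_le_Cons_tail: "lex_le (x # a) (y # b) \<Longrightarrow> lex_le a b"
  by (auto simp: lex_le_refl split: if_splits)

text \<open>Lex sets and stable sets are both down-sets, for two different orders on the same lists;
  \<open>R v u\<close> reads as \<open>v\<close> below \<open>u\<close>.\<close>

definition lower_set :: "('a \<Rightarrow> 'a \<Rightarrow> bool) \<Rightarrow> 'a set \<Rightarrow> 'a set \<Rightarrow> bool" where
  "lower_set R S A \<longleftrightarrow> A \<subseteq> S \<and> (\<forall>u\<in>A. \<forall>v\<in>S. R v u \<longrightarrow> v \<in> A)"

lemma lower_setD: "lower_set R S A \<Longrightarrow> u \<in> A \<Longrightarrow> v \<in> S \<Longrightarrow> R v u \<Longrightarrow> v \<in> A"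
  by (auto simp: lower_set_def)

lemma lower_set_Int: "lower_set R S A \<Longrightarrow> T \<subseteq> S \<Longrightarrow> lower_set R T (A \<inter> T)"
  by (auto simp: lower_set_def)

abbreviation lex_set :: "(nat \<Rightarrow> nat) \<Rightarrow> nat \<Rightarrow> nat \<Rightarrow> nat list set \<Rightarrow> bool" where
  "lex_set s l m \<equiv> lower_set lex_le (spread_lists s l m)"

abbreviation stable_set :: "(nat \<Rightarrow> nat) \<Rightarrow> nat \<Rightarrow> nat \<Rightarrow> nat list set \<Rightarrow> bool" where
  "stable_set s l m \<equiv> lower_set (list_all2 (\<le>)) (spread_lists s l m)"

lemma finite_lower_set: "lower_set R (spread_lists s l m) A \<Longrightarrow> finite A"
  unfolding lower_set_def using finite_spread_lists finite_subset by blast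

lemma lex_set_imp_stable_set: "lex_set s l m A \<Longrightarrow> stable_set s l m A"
  unfolding lower_set_def using lex_le_if_componentwise by blast

text \<open>The order is total on lists of one length, so its lower sets form a chain, and sizes
  decide the direction of inclusion.\<close>

lemma lex_set_subset:
  assumes A: "lex_set s l m A" and B: "lex_set s l m B" and card: "card A \<le> card B"
  shows "A \<subseteq> B"
proof (rule ccontr)
  assume "\<not> A \<subseteq> B"
  then obtain u where u: "u \<in> A" "u \<notin> B" by blast
  have "B \<subseteq> A"
  proof
    fix v assume v: "v \<in> B"
    have in_S: "u \<in> spread_lists s l m" "v \<in> spread_lists s l m"
      using A B u v by (auto simp: lower_set_def)
    then have "lex_le u v \<or> lex_le v u"
      using lex_le_total length_spread_lists by metis
    then show "v \<in> A"
      using lower_setD[OF B v in_S(1)] lower_setD[OF A u(1) in_S(2)] u(2) by blast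
  qed
  then have "A = B"
    using card finite_lower_set[OF A] card_seteq by blast
  then show False using u by simp
qed

lemma ex_lex_least:
  assumes "finite A" "A \<noteq> {}" "\<forall>w\<in>A. length w = l"
  shows "\<exists>x\<in>A. \<forall>y\<in>A. lex_le x y"
  using assms
proof (induction rule: finite_ne_induct)
  case (insert x F)
  then obtain y where y: "y \<in> F" "\<forall>z\<in>F. lex_le y z" by auto
  show ?case
  proof (cases "lex_le x y")
    case True
    then have "\<forall>z\<in>F. lex_le x z"
      using y insert.prems lex_le_trans[of x y] by auto
    then show ?thesis by (auto simp: lex_le_refl)
  next
    case False
    then have "lex_le y x" using lex_le_total[of x y] insert.prems y(1) by auto
    then show ?thesis using y by auto
  qed
qed (simp add: lex_le_refl)

text \<open>Adding the least list outside a lex set gives a lex set with one more element.\<close>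

lemma ex_lex_set_card:
  "k \<le> card (spread_lists s l m) \<Longrightarrow> \<exists>A. lex_set s l m A \<and> card A = k"
proof (induction k)
  case 0
  show ?case by (rule exI[of _ "{}"]) (simp add: lower_set_def)
next
  case (Suc k)
  let ?S = "spread_lists s l m"
  obtain A where A: "lex_set s l m A" "card A = k" using Suc by auto
  then have sub: "A \<subseteq> ?S" by (simp add: lower_set_def)
  have "?S - A \<noteq> {}"
    using Suc.prems A(2) card_mono[OF finite_lower_set[OF A(1)], of ?S] by auto
  then obtain x where x: "x \<in> ?S - A" "\<forall>y\<in>?S - A. lex_le x y"
    using ex_lex_least[of "?S - A" l] finite_spread_lists length_spread_lists by blast
  have "lex_set s l m (insert x A)"
    unfolding lower_set_def
  proof (intro conjI ballI impI)
    fix u v assume "u \<in> insert x A" and v: "v \<in> ?S" "lex_le v u"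
    then consider "u = x" | "u \<in> A" by blast
    then show "v \<in> insert x A"
    proof cases
      case 1
      then show ?thesis
        using x v lex_le_antisym[of v x] length_spread_lists[of _ s l m] by auto
    next
      case 2
      then show ?thesis using lower_setD[OF A(1)] v by blast
    qed
  qed (use x sub in auto)
  moreover have "card (insert x A) = Suc k"
    using A x finite_lower_set[OF A(1)] by simp
  ultimately show ?case by blast
qed

text \<open>Only a new largest entry is prepended. For a stable \<open>B\<close> within bound
  \<open>m\<close> this gives all spread multiples of degree \<open>l + 1\<close> within bound
  \<open>m\<close>, since the tail of such a multiple lies componentwise below the divisor.\<close>

definition shadow :: "(nat \<Rightarrow> nat) \<Rightarrow> nat \<Rightarrow> nat \<Rightarrow> nat list set \<Rightarrow> nat list set" where
  "shadow s l m B = {x # b | x b. 1 \<le> x \<and> x \<le> m \<and> b \<in> B \<inter> spread_lists s l (x - s l)}"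

text \<open>Head and tail determine a list, so the size of a shadow depends only on how many
  elements of \<open>B\<close> lie within each bound.\<close>

lemma card_shadow:
  assumes "finite B"
  shows "card (shadow s l m B) = (\<Sum>x = 1..m. card (B \<inter> spread_lists s l (x - s l)))"
proof -
  have "shadow s l m B =
      (\<lambda>(x, b). x # b) ` (SIGMA x:{1..m}. B \<inter> spread_lists s l (x - s l))"
    by (force simp: shadow_def)
  moreover have "inj_on (\<lambda>(x, b). x # b) X" for X :: "(nat \<times> nat list) set"
    by (auto simp: inj_on_def)
  ultimately show ?thesis
    using assms by (simp add: card_image)
qed

text \<open>Tails are compared before heads, so a list below \<open>x # b\<close> has a tail below
  \<open>b\<close>. Assumption \<open>q\<close> puts every admissible tail in the range where
  \<open>A\<close> is a lower set.\<close>

lemma lex_set_shadow: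
  assumes A: "lex_set s l q A" and q: "m - s l \<le> q"
  shows "lex_set s (Suc l) m (shadow s l m A)"
  unfolding lower_set_def
proof (intro conjI ballI impI)
  fix u v assume u: "u \<in> shadow s l m A" and v: "v \<in> spread_lists s (Suc l) m" "lex_le v u"
  obtain x b where xb: "u = x # b" "b \<in> A" using u by (auto simp: shadow_def)
  obtain y c where yc: "v = y # c" "1 \<le> y" "y \<le> m" "c \<in> spread_lists s l (y - s l)"
    using v by auto
  have "c \<in> spread_lists s l q"
    by (rule spread_lists_mono[OF yc(4)]) (use yc q in simp)
  moreover have "lex_le c b" using v(2) xb yc lex_le_Cons_tail by blast
  ultimately show "v \<in> shadow s l m A"
    using lower_setD[OF A xb(2)] yc by (auto simp: shadow_def)
qed (auto simp: shadow_def)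

text \<open>
  Lists in \<open>spread_lists s l m\<close> are retracted to bound \<open>m - 1\<close> by lowering entries as little
  as possible, and this retraction is monotone for the lexicographic order.
\<close>

lemma ex_lower_below:
  assumes "u \<in> spread_lists s l (m - 1)" "v \<in> spread_lists s l m" "lex_le u v"
  shows "\<exists>v'\<in>spread_lists s l (m - 1). list_all2 (\<le>) v' v \<and> lex_le u v'"
  using assms
proof (induction l arbitrary: m u v)
  case (Suc l)
  obtain y c where u: "u = y # c" "1 \<le> y" "y \<le> m - 1" "c \<in> spread_lists s l (y - s l)"
    using Suc.prems by auto
  obtain x b where v: "v = x # b" "1 \<le> x" "x \<le> m" "b \<in> spread_lists s l (x - s l)"
    using Suc.prems by auto
  show ?case
  proof (cases "x = m")
    case False
    then have "v \<in> spread_lists s (Suc l) (m - 1)" using v by auto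
    then show ?thesis using Suc.prems(3) by (auto intro!: bexI[of _ v] list_all2_refl)
  next
    case True
    \<comment> \<open>A head equal to \<open>m\<close> has to drop to \<open>m - 1\<close>, and the
      bound of the tail then drops to \<open>m - s l - 1\<close>; the induction hypothesis retracts
      the tail accordingly.\<close>
    have "c \<in> spread_lists s l (m - s l - 1)"
      by (rule spread_lists_mono[OF u(4)]) (use u in simp)
    moreover have "lex_le c b" using Suc.prems(3) u v lex_le_Cons_tail by blast
    ultimately obtain b' where b': "b' \<in> spread_lists s l (m - s l - 1)"
      "list_all2 (\<le>) b' b" "lex_le c b'"
      using Suc.IH[of c "m - s l" b] v True by blast
    have "(m - 1) # b' \<in> spread_lists s (Suc l) (m - 1)"
      using b' u by (auto simp: diff_commute)
    moreover have "list_all2 (\<le>) ((m - 1) # b') v" using b' v True by simp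
    moreover have "lex_le u ((m - 1) # b')" using b' u by simp
    ultimately show ?thesis by blast
  qed
qed simp

section \<open>Bayer's comparison of lex sets with stable sets\<close>

lemma card_split_last:
  assumes "D \<subseteq> spread_lists s (Suc l) (Suc m)"
  shows "card D = card (D \<inter> spread_lists s (Suc l) m) + card {b. Suc m # b \<in> D}"
proof -
  have fin: "finite D" using assms finite_spread_lists finite_subset by blast
  have "D = (D \<inter> spread_lists s (Suc l) m) \<union> (#) (Suc m) ` {b. Suc m # b \<in> D}"
    using assms by (auto simp: le_Suc_eq)
  moreover have "finite ((#) (Suc m) ` {b. Suc m # b \<in> D})"
    by (rule finite_subset[OF _ fin]) auto
  moreover have "(D \<inter> spread_lists s (Suc l) m) \<inter> (#) (Suc m) ` {b. Suc m # b \<in> D} = {}"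
    by auto
  ultimately have "card D = card (D \<inter> spread_lists s (Suc l) m)
      + card ((#) (Suc m) ` {b. Suc m # b \<in> D})"
    using fin by (metis card_Un_disjoint finite_Int)
  then show ?thesis by (simp add: card_image)
qed

text \<open>If \<open>L\<close> had more elements within bound \<open>m\<close> than
  \<open>D\<close>, some \<open>u\<close> of \<open>L\<close> within that bound would be missing
  from the lex replacement \<open>A0\<close> of \<open>D0\<close>. Everything in \<open>N\<close>,
  the union of both replaced pieces, is then strictly below \<open>u\<close>, hence in
  \<open>L - {u}\<close>; but \<open>N\<close> has the size of \<open>D\<close>, which is at least
  that of \<open>L\<close>.\<close>

lemma stable_set_card_below_ge:
  assumes D: "stable_set s (Suc l) (Suc m) D" and L: "lex_set s (Suc l) (Suc m) L"
    and card: "card L \<le> card D"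
    and IH: "\<And>m D L q. stable_set s l m D \<Longrightarrow> lex_set s l m L \<Longrightarrow> card L \<le> card D \<Longrightarrow>
      card (L \<inter> spread_lists s l q) \<le> card (D \<inter> spread_lists s l q)"
  shows "card (L \<inter> spread_lists s (Suc l) m) \<le> card (D \<inter> spread_lists s (Suc l) m)"
proof (rule ccontr)
  let ?S = "spread_lists s (Suc l) m" and ?m1 = "Suc m - s l"
  define D0 where "D0 = D \<inter> ?S"
  define D1 where "D1 = {b. Suc m # b \<in> D}"
  assume "\<not> card (L \<inter> ?S) \<le> card (D \<inter> ?S)"
  then have less: "card D0 < card (L \<inter> ?S)" by (simp add: D0_def)
  have S_sub: "?S \<subseteq> spread_lists s (Suc l) (Suc m)"
    by (intro subsetI, erule spread_lists_mono) simp
  have D_sub: "D \<subseteq> spread_lists s (Suc l) (Suc m)" using D by (simp add: lower_set_def)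
  have D1: "stable_set s l ?m1 D1"
    unfolding lower_set_def
  proof (intro conjI ballI impI)
    show "D1 \<subseteq> spread_lists s l ?m1" using D_sub by (auto simp: D1_def)
    show "v \<in> D1" if "u \<in> D1" "v \<in> spread_lists s l ?m1" "list_all2 (\<le>) v u" for u v
      using lower_setD[OF D, of "Suc m # u" "Suc m # v"] that by (simp add: D1_def)
  qed
  obtain A0 where A0: "lex_set s (Suc l) m A0" "card A0 = card D0"
    using ex_lex_set_card[of "card D0" s "Suc l" m] card_mono[OF finite_spread_lists, of D0 s "Suc l" m]
    by (auto simp: D0_def)
  have "card D1 \<le> card (spread_lists s l ?m1)"
    using D1 by (auto simp: lower_set_def intro!: card_mono finite_spread_lists)
  then obtain A1 where A1: "lex_set s l ?m1 A1" "card A1 = card D1"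
    using ex_lex_set_card by blast
  \<comment> \<open>Lowering the head \<open>Suc m\<close> to an admissible \<open>x <= m\<close>
    stays in \<open>D\<close> by stability. This links the two pieces.\<close>
  have "shadow s l m D1 \<subseteq> D0"
  proof
    fix w assume "w \<in> shadow s l m D1"
    then obtain x b where w: "w = x # b" "1 \<le> x" "x \<le> m" "Suc m # b \<in> D"
        "b \<in> spread_lists s l (x - s l)"
      by (auto simp: shadow_def D1_def)
    then have "w \<in> ?S" by auto
    moreover have "list_all2 (\<le>) w (Suc m # b)" using w by (simp add: list_all2_refl)
    ultimately show "w \<in> D0"
      using lower_setD[OF D w(4)] S_sub by (auto simp: D0_def)
  qed
  then have "card (shadow s l m D1) \<le> card A0"
    using A0(2) finite_spread_lists[of s "Suc l" m] by (auto simp: D0_def intro!: card_mono)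
  \<comment> \<open>The hypothesis for degree \<open>l\<close> compares the summands of the two
    shadow sizes. The link between the pieces thus survives their replacement by lex sets.\<close>
  moreover have "card (shadow s l m A1) \<le> card (shadow s l m D1)"
    using IH[OF D1 A1(1)] A1 D1 by (auto simp: card_shadow finite_lower_set intro!: sum_mono)
  ultimately have shadow_sub: "shadow s l m A1 \<subseteq> A0"
    by (intro lex_set_subset[OF lex_set_shadow[OF A1(1)] A0(1)]) auto
  have "\<not> L \<inter> ?S \<subseteq> A0"
    using less A0 card_mono[OF finite_lower_set[OF A0(1)]] by (metis not_le)
  then obtain u where u: "u \<in> L" "u \<in> ?S" "u \<notin> A0" by blast
  define N where "N = A0 \<union> (#) (Suc m) ` A1"
  have "v \<in> L - {u}" if "v \<in> N" for v
  proof -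
    have v: "v \<in> spread_lists s (Suc l) (Suc m)"
      using that A0(1) A1(1) S_sub by (auto simp: N_def lower_set_def simp del: spread_lists.simps(2))
        (auto simp: lower_set_def)
    have "\<not> lex_le u v"
    proof
      assume le: "lex_le u v"
      from that consider "v \<in> A0" | b where "v = Suc m # b" "b \<in> A1" by (auto simp: N_def)
      then show False
      proof cases
        case 1
        then show False using lower_setD[OF A0(1) _ u(2) le] u(3) by blast
      next
        case 2
        obtain y c where yc: "u = y # c" "1 \<le> y" "y \<le> m" "c \<in> spread_lists s l (y - s l)"
          using u by auto
        have "c \<in> spread_lists s l (?m1 - 1)"
          by (rule spread_lists_mono[OF yc(4)]) (use yc in simp)
        moreover have "b \<in> spread_lists s l ?m1" using A1(1) 2 by (auto simp: lower_set_def)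
        moreover have "lex_le c b" using le 2 yc lex_le_Cons_tail by blast
        \<comment> \<open>Retracting \<open>b\<close> keeps it in \<open>A1\<close> and preserves
          \<open>lex_le c b'\<close>. So \<open>m # b'\<close> lies in the shadow of
          \<open>A1\<close>, hence in \<open>A0\<close>, and \<open>u\<close> below it would lie in
          \<open>A0\<close> too.\<close>
        ultimately obtain b' where b': "b' \<in> spread_lists s l (?m1 - 1)"
            "list_all2 (\<le>) b' b" "lex_le c b'"
          using ex_lower_below[of c s l ?m1 b] by blast
        then have "b' \<in> A1"
          using lower_setD[OF lex_set_imp_stable_set[OF A1(1)] 2(2)]
            spread_lists_mono[of b' s l "?m1 - 1" ?m1] by auto
        then have "m # b' \<in> A0"
          using shadow_sub b' yc by (auto simp: shadow_def diff_commute Suc_diff_le)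
        moreover have "lex_le u (m # b')" using b' yc by simp
        ultimately show False using lower_setD[OF A0(1) _ u(2)] u(3) by blast
      qed
    qed
    then have "lex_le v u" "v \<noteq> u"
      using lex_le_total[of v u] v u S_sub length_spread_lists lex_le_refl by (metis subsetD, auto)
    then show ?thesis using lower_setD[OF L u(1) v] by simp
  qed
  then have "N \<subseteq> L - {u}" by blast
  then have "card N < card L"
    using u(1) finite_lower_set[OF L] by (meson card_Diff1_less card_mono finite_Diff le_less_trans)
  moreover have "card N = card A0 + card A1"
  proof -
    have "A0 \<inter> (#) (Suc m) ` A1 = {}" using A0(1) by (auto simp: lower_set_def)
    then show ?thesis
      using finite_lower_set[OF A0(1)] finite_lower_set[OF A1(1)]
      by (simp add: N_def card_Un_disjoint card_image)
  qed
  ultimately show False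
    using card A0 A1 card_split_last[OF D_sub] by (simp add: D0_def D1_def)
qed

text \<open>Induction on the degree and, inside it, on the bound. For \<open>q <= m\<close> both
  sets are first cut to bound \<open>m\<close>, which keeps the size inequality by
  \<open>stable_set_card_below_ge\<close>; for larger \<open>q\<close> nothing is cut.\<close>

lemma lex_set_card_le_stable_set:
  assumes "stable_set s l m D" "lex_set s l m L" "card L \<le> card D"
  shows "card (L \<inter> spread_lists s l q) \<le> card (D \<inter> spread_lists s l q)"
  using assms
proof (induction l arbitrary: m D L q)
  case 0
  then show ?case by (auto simp: lower_set_def Int_absorb2)
next
  case (Suc l)
  note IH = Suc.IH
  show ?case
    using Suc.prems
  proof (induction m arbitrary: D L)
    case 0
    then show ?case by (simp add: lower_set_def)
  next
    case (Suc m)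
    let ?S = "spread_lists s (Suc l)"
    show ?case
    proof (cases "q \<le> m")
      case True
      have sub: "?S m \<subseteq> ?S (Suc m)" "?S q \<subseteq> ?S m"
        using True by (auto elim: spread_lists_mono simp del: spread_lists.simps)
      have "card (L \<inter> ?S m) \<le> card (D \<inter> ?S m)"
        by (rule stable_set_card_below_ge[OF Suc.prems]) (rule IH)
      then have "card (L \<inter> ?S m \<inter> ?S q) \<le> card (D \<inter> ?S m \<inter> ?S q)"
        using Suc.IH[OF lower_set_Int[OF Suc.prems(1) sub(1)] lower_set_Int[OF Suc.prems(2) sub(1)]]
        by blast
      then show ?thesis
        using sub(2) by (simp add: Int_assoc Int_absorb1 del: spread_lists.simps)
    next
      case False
      then have "?S (Suc m) \<subseteq> ?S q" by (intro subsetI, elim spread_lists_mono) simp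
      then have "L \<inter> ?S q = L" "D \<inter> ?S q = D"
        using Suc.prems by (auto simp: lower_set_def simp del: spread_lists.simps)
      then show ?thesis using Suc.prems by simp
    qed
  qed
qed


section \<open>Spread monomials as descending lists\<close>

text \<open>Shifts to gaps counted from 1. The value at 0 only bounds the empty tail, where every
  bound gives the same set.\<close>

definition gap :: "nat list \<Rightarrow> nat \<Rightarrow> nat" where
  "gap t i = t ! (i - 1)"

lemma spread_lists_iff:
  "w \<in> spread_lists s l n \<longleftrightarrow> length w = l \<and> sorted (rev w) \<and> set w \<subseteq> {1..n} \<and>
     (\<forall>i. Suc i < l \<longrightarrow> rev w ! i + s (Suc i) \<le> rev w ! Suc i)"
proof (induction l arbitrary: w n)
  case (Suc l)
  show ?case (is "_ \<longleftrightarrow> ?R")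
  proof
    assume "w \<in> spread_lists s (Suc l) n"
    then obtain x b where w: "w = x # b" "1 \<le> x" "x \<le> n" and b: "b \<in> spread_lists s l (x - s l)"
      by auto
    have le: "y + s l \<le> x" "1 \<le> y" if "y \<in> set b" for y
      using b that unfolding Suc.IH by fastforce+
    have "rev w ! i + s (Suc i) \<le> rev w ! Suc i" if i: "Suc i < Suc l" for i
    proof (cases "Suc i < l")
      case True
      then show ?thesis using b unfolding Suc.IH by (simp add: w nth_append)
    next
      case False
      then have "i < length b" "Suc i = length b" using b i unfolding Suc.IH by auto
      moreover from this have "rev b ! i \<in> set b" using nth_mem[of i "rev b"] by simp
      ultimately show ?thesis
        using le(1) b unfolding Suc.IH by (simp add: w nth_append)
    qed
    then show ?R
      using b w le unfolding Suc.IH by (fastforce simp: sorted_append)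
  next
    assume R: ?R
    then obtain x b where w: "w = x # b" "length b = l" by (cases w) auto
    have R_gaps: "rev w ! i + s (Suc i) \<le> rev w ! Suc i" if "Suc i < Suc l" for i
      using R that by blast
    have b: "sorted (rev b)" and b_pos: "\<And>y. y \<in> set b \<Longrightarrow> 1 \<le> y" and x: "1 \<le> x" "x \<le> n"
      using R by (auto simp: w sorted_append)
    have gaps: "rev b ! i + s (Suc i) \<le> rev b ! Suc i" if "Suc i < l" for i
      using R_gaps[of i] that w by (simp add: nth_append)
    \<comment> \<open>The last gap separates \<open>x\<close> from the largest entry of
      \<open>b\<close>, hence from all its entries.\<close>
    have "y + s l \<le> x" if y: "y \<in> set b" for y
    proof -
      have l: "0 < l" using y w by auto
      obtain i where i: "i < l" "rev b ! i = y"
        using y w by (metis in_set_conv_nth length_rev set_rev)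
      then have "y \<le> rev b ! (l - 1)"
        using sorted_nth_mono[OF b, of i "l - 1"] w(2) by simp
      also have "rev b ! (l - 1) + s l \<le> x"
        using R_gaps[of "l - 1"] l w by (simp add: nth_append)
      finally show ?thesis by simp
    qed
    then have "set b \<subseteq> {1..x - s l}" using b_pos by fastforce
    then have "b \<in> spread_lists s l (x - s l)"
      unfolding Suc.IH using w(2) b gaps by simp
    then show "w \<in> spread_lists s (Suc l) n" using w(1) x by simp
  qed
qed auto

section \<open>Passage between lists and multisets\<close>

lemma sorted_rev_spread_lists: "w \<in> spread_lists s l n \<Longrightarrow> sorted (rev w)"
  by (simp add: spread_lists_iff)

lemma sorted_list_of_mset_eq_rev:
  "sorted (rev w) \<Longrightarrow> sorted_list_of_multiset (mset w) = rev w"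
  by (simp add: sorted_list_of_multiset_mset properties_for_sort)

lemma mset_spread_lists:
  assumes "w \<in> spread_lists (gap t) l n" "l \<le> d"
  shows "mset w \<in> t_spread_monomials n d t l"
  using assms sorted_list_of_mset_eq_rev[of w]
  by (auto simp: t_spread_monomials_def t_spread_def spread_lists_iff gap_def Let_def)

lemma ex_spread_list:
  assumes "u \<in> t_spread_monomials n d t l"
  shows "\<exists>w\<in>spread_lists (gap t) l n. mset w = u"
proof
  show "mset (rev (sorted_list_of_multiset u)) = u" by simp
  have "length (sorted_list_of_multiset u) = l"
    using assms by (simp add: t_spread_monomials_def flip: size_mset)
  then show "rev (sorted_list_of_multiset u) \<in> spread_lists (gap t) l n"
    using assms by (auto simp: t_spread_monomials_def t_spread_def spread_lists_iff gap_def Let_def)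
qed

lemma inj_on_mset_spread_lists: "inj_on mset (spread_lists s l n)"
  by (rule inj_onI) (metis rev_rev_ident sorted_list_of_mset_eq_rev sorted_rev_spread_lists)

text \<open>The last entry is the smallest index and decides first, as in the order on
  monomials.\<close>

lemma lex_le_snoc:
  "length a = length b \<Longrightarrow> lex_le (a @ [x]) (b @ [y]) \<longleftrightarrow> x < y \<or> x = y \<and> lex_le a b"
  by (induction a b rule: list_induct2) auto

lemma lex_ge_mset_if_lex_le_rev:
  assumes "length a = length b" "sorted a" "sorted b" "lex_le (rev a) (rev b)"
  shows "lex_ge (mset a) (mset b)"
  using assms
proof (induction a b rule: list_induct2)
  case (Cons x a y b)
  then have "x < y \<or> x = y \<and> lex_le (rev a) (rev b)" by (simp add: lex_le_snoc)
  then show ?case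
  proof
    assume "x < y"
    \<comment> \<open>The index \<open>x\<close> is the first place where the exponents differ:
      nothing below it occurs on either side, and it occurs only in \<open>x # a\<close>.\<close>
    then have "count (mset (y # b)) j = 0" if "j \<le> x" for j
      using Cons.prems(2) that by (auto simp: count_eq_zero_iff)
    moreover have "count (mset (x # a)) j = 0" if "j < x" for j
      using Cons.prems(1) that by (auto simp: count_eq_zero_iff)
    ultimately show ?thesis
      unfolding lex_ge_def by (intro disjI2 exI[of _ x]) simp
  next
    assume "x = y \<and> lex_le (rev a) (rev b)"
    then show ?thesis using Cons by (fastforce simp: lex_ge_def)
  qed
qed (simp add: lex_ge_def)

lemma lex_ge_antisym: "lex_ge u v \<Longrightarrow> lex_ge v u \<Longrightarrow> u = v"
  unfolding lex_ge_def by (metis less_asym' linorder_neqE_nat)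

text \<open>The converse follows from totality of \<open>lex_le\<close>, antisymmetry of
  \<open>lex_ge\<close> and injectivity of \<open>mset\<close>.\<close>

lemma lex_ge_mset_iff:
  assumes v: "v \<in> spread_lists s l n" and u: "u \<in> spread_lists s l n"
  shows "lex_ge (mset v) (mset u) \<longleftrightarrow> lex_le v u"
proof -
  have le: "lex_ge (mset a) (mset b)"
    if "lex_le a b" "a \<in> spread_lists s l n" "b \<in> spread_lists s l n" for a b
    using lex_ge_mset_if_lex_le_rev[of "rev a" "rev b"] that by (simp add: spread_lists_iff)
  show ?thesis
  proof
    assume ge: "lex_ge (mset v) (mset u)"
    show "lex_le v u"
    proof (rule ccontr)
      assume not: "\<not> lex_le v u"
      then have "lex_le u v" using lex_le_total[of u v] u v length_spread_lists by metis
      then have "mset u = mset v" using lex_ge_antisym ge le u v by blast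
      then show False
        using inj_on_mset_spread_lists u v not lex_le_refl by (metis inj_onD)
    qed
  qed (use le u v in blast)
qed

text \<open>The list form of \<open>t_spread_part\<close>. It carries no degree bound, so the two
  are compared only for \<open>l <= d\<close>.\<close>

definition list_part :: "nat \<Rightarrow> nat list \<Rightarrow> (nat multiset \<Rightarrow>\<^sub>0 'k::field) set \<Rightarrow> nat \<Rightarrow> nat list set" where
  "list_part n t I l = {w \<in> spread_lists (gap t) l n. monomial (mset w) \<in> I}"

lemma list_part_subset: "list_part n t I l \<subseteq> spread_lists (gap t) l n"
  by (auto simp: list_part_def)

lemma t_spread_part_eq_image:
  "l \<le> d \<Longrightarrow> t_spread_part n d t I l = mset ` list_part n t I l"
  unfolding t_spread_part_def list_part_def
  using mset_spread_lists ex_spread_list by (fastforce simp: image_iff)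

lemma t_spread_part_empty: "d < l \<Longrightarrow> t_spread_part n d t I l = {}"
  by (auto simp: t_spread_part_def t_spread_monomials_def t_spread_def)

lemma card_t_spread_part:
  "l \<le> d \<Longrightarrow> card (t_spread_part n d t I l) = card (list_part n t I l)"
  by (simp add: t_spread_part_eq_image card_image
      inj_on_subset[OF inj_on_mset_spread_lists list_part_subset])

lemma f_vector_eq_iff:
  "f_vector n d t I = f_vector n d t J \<longleftrightarrow>
    (\<forall>l\<le>d. card (list_part n t I l) = card (list_part n t J l))"
proof -
  have "f_vector n d t I = f_vector n d t J \<longleftrightarrow>
      (\<forall>l\<in>{0..<Suc d}. card (t_spread_part n d t I l) = card (t_spread_part n d t J l))"
    by (simp add: f_vector_def del: upt_Suc)
  also have "\<dots> \<longleftrightarrow> (\<forall>l\<le>d. card (list_part n t I l) = card (list_part n t J l))"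
    by (auto simp: card_t_spread_part less_Suc_eq_le)
  finally show ?thesis .
qed

lemma t_spread_lex_set_iff:
  assumes "l \<le> d"
  shows "t_spread_lex_set n d t l (t_spread_part n d t I l) \<longleftrightarrow>
    lex_set (gap t) l n (list_part n t I l)"
proof
  assume L: "t_spread_lex_set n d t l (t_spread_part n d t I l)"
  show "lex_set (gap t) l n (list_part n t I l)"
    unfolding lower_set_def
  proof (intro conjI ballI impI list_part_subset)
    fix u v assume u: "u \<in> list_part n t I l" and v: "v \<in> spread_lists (gap t) l n" "lex_le v u"
    have "mset u \<in> t_spread_part n d t I l" using u assms t_spread_part_eq_image by blast
    moreover have "lex_ge (mset v) (mset u)"
      using lex_ge_mset_iff v u list_part_subset by blast
    ultimately have "mset v \<in> t_spread_part n d t I l"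
      using L mset_spread_lists[OF v(1) assms] by (simp add: t_spread_lex_set_def)
    then show "v \<in> list_part n t I l"
      using v by (simp add: t_spread_part_def list_part_def)
  qed
next
  assume L: "lex_set (gap t) l n (list_part n t I l)"
  show "t_spread_lex_set n d t l (t_spread_part n d t I l)"
    unfolding t_spread_lex_set_def
  proof (intro conjI ballI impI)
    fix u v assume u: "u \<in> t_spread_part n d t I l" and v: "v \<in> t_spread_monomials n d t l" "lex_ge v u"
    obtain a where a: "a \<in> list_part n t I l" "u = mset a"
      using u assms t_spread_part_eq_image by blast
    obtain b where b: "b \<in> spread_lists (gap t) l n" "v = mset b"
      using v ex_spread_list by blast
    have "lex_le b a"
      using lex_ge_mset_iff[OF b(1)] a b v list_part_subset by blast
    then show "v \<in> t_spread_part n d t I l"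
      using lower_setD[OF L a(1) b(1)] b(2) assms t_spread_part_eq_image by blast
  qed (auto simp: t_spread_part_def)
qed

text \<open>The prefix \<open>p\<close> constrains what follows only through the largest entry of
  \<open>a\<close>, and \<open>b\<close> does not raise that entry.\<close>

lemma spread_lists_append_lower:
  assumes "p @ a \<in> spread_lists s l n" "b \<in> spread_lists s (length a) m" "list_all2 (\<le>) b a"
  shows "p @ b \<in> spread_lists s l n"
  using assms
proof (induction p arbitrary: l n)
  case Nil
  then have "length a = l" using length_spread_lists by force
  then show ?case
    using Nil by (cases l) (auto simp: list_all2_Cons1)
next
  case (Cons x p)
  then show ?case by (cases l) auto
qed

text \<open>
  Lowering entries one at a time, beginning with the smallest, keeps the monomial spread.
\<close>

lemma strongly_stable_lower:
  assumes stable: "t_spread_strongly_stable_set n d t l L" and l: "l \<le> d"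
    and "list_all2 (\<le>) v w" "p @ w \<in> spread_lists (gap t) l n"
    "v \<in> spread_lists (gap t) (length w) m" "mset (p @ w) \<in> L"
  shows "mset (p @ v) \<in> L"
  using assms(3-)
proof (induction v w arbitrary: p m rule: list_all2_induct)
  case (Cons y v x w)
  have v: "v \<in> spread_lists (gap t) (length w) (y - gap t (length w))"
    using Cons.prems(2) by simp
  \<comment> \<open>The tail is lowered while \<open>x\<close> is still in place, as part of the
    prefix; a single exchange of \<open>x\<close> for \<open>y\<close> then finishes.\<close>
  have mem: "mset (p @ x # v) \<in> L"
    using Cons.IH[of "p @ [x]", OF _ v] Cons.prems by simp
  have "p @ y # v \<in> spread_lists (gap t) l n"
    by (rule spread_lists_append_lower[OF Cons.prems(1,2)]) (use Cons.hyps in simp)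
  then have spread: "t_spread n d t (mset (p @ y # v))"
    using mset_spread_lists[OF _ l] unfolding t_spread_monomials_def by blast
  show ?case
  proof (cases "y = x")
    case False
    have eq: "add_mset y (mset (p @ x # v) - {#x#}) = mset (p @ y # v)" by simp
    have "y < x" "x \<in># mset (p @ x # v)" using Cons.hyps False by auto
    then show ?thesis
      using stable mem spread unfolding t_spread_strongly_stable_set_def eq[symmetric] by blast
  qed (use mem in simp)
qed simp

lemma stable_set_list_part:
  assumes "t_spread_strongly_stable_set n d t l (t_spread_part n d t I l)" "l \<le> d"
  shows "stable_set (gap t) l n (list_part n t I l)"
  unfolding lower_set_def
proof (intro conjI ballI impI list_part_subset)
  fix u v assume u: "u \<in> list_part n t I l"
    and v: "v \<in> spread_lists (gap t) l n" "list_all2 (\<le>) v u"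
  have "mset u \<in> t_spread_part n d t I l" using u assms(2) t_spread_part_eq_image by blast
  moreover have "u \<in> spread_lists (gap t) l n" using u list_part_subset by blast
  moreover from this have "length u = l" using length_spread_lists by blast
  ultimately have "mset v \<in> t_spread_part n d t I l"
    using strongly_stable_lower[OF assms v(2), of "[]"] v(1) by simp
  then show "v \<in> list_part n t I l" using v by (simp add: t_spread_part_def list_part_def)
qed

text \<open>The \<open>i\<close>-th smallest element of a multiset is at most the
  \<open>i\<close>-th smallest of any submultiset; dropping the front of a descending list leaves
  its smallest entries.\<close>

lemma drop_le_of_subseteq_mset:
  assumes "sorted (rev w)" "sorted (rev g)" "mset g \<subseteq># mset w"
  shows "list_all2 (\<le>) (drop (length w - length g) w) g"
  using assms
proof (induction w arbitrary: g)
  case (Cons x w)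
  have len: "length g \<le> Suc (length w)" using size_mset_mono[OF Cons.prems(3)] by simp
  show ?case
  proof (cases "length g = Suc (length w)")
    case True
    then have "mset g = mset (x # w)"
      using Cons.prems(3) mset_subset_size[of "mset g" "mset (x # w)"]
      by (auto simp: subset_mset.less_le)
    then have "g = x # w"
      using Cons.prems sorted_list_of_mset_eq_rev by (metis rev_rev_ident)
    then show ?thesis by (simp add: list_all2_refl)
  next
    case False
    then have drop: "drop (length (x # w) - length g) (x # w) = drop (length w - length g) w"
      using len by (simp add: Suc_diff_le)
    show ?thesis
    proof (cases "mset g \<subseteq># mset w")
      case True
      then show ?thesis using Cons drop by (simp add: sorted_append)
    next
      case not_sub: False
      \<comment> \<open>If this copy of \<open>x\<close> cannot be spared, \<open>x\<close> occurs
        in \<open>g\<close>. Being the largest entry, it is the head of \<open>g\<close>, and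
        cancelling it leaves \<open>g'\<close> inside \<open>w\<close>.\<close>
      have x: "x \<in># mset g"
        using Cons.prems(3) not_sub
        by (metis add_mset_remove_trivial diff_subset_eq_self diff_single_trivial mset.simps(2) subset_eq_diff_conv subset_mset.order_trans)
      then obtain y g' where g: "g = y # g'" by (cases g) auto
      have "y \<in> set (x # w)"
        using Cons.prems(3) g by (metis list.set_intros(1) mset_subset_eqD set_mset_mset)
      then have "y = x" using Cons.prems x g by (fastforce simp: sorted_append)
      then have "mset g' \<subseteq># mset w" using Cons.prems(3) g by simp
      then have IH: "list_all2 (\<le>) (drop (length w - length g') w) g'"
        using Cons g by (simp add: sorted_append)
      define k where "k = length w - length g"
      have k: "k < length w" "length w - length g' = Suc k"
        using False len g by (auto simp: k_def)
      then have "drop k w = w ! k # drop (Suc k) w" by (simp add: Cons_nth_drop_Suc)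
      moreover have "w ! k \<le> x" using Cons.prems(1) k by (simp add: sorted_append)
      ultimately show ?thesis using IH k g \<open>y = x\<close> drop by (simp add: k_def)
    qed
  qed
qed simp

lemma drop_spread_lists: "w \<in> spread_lists s l n \<Longrightarrow> drop j w \<in> spread_lists s (l - j) n"
proof (induction j)
  case (Suc j)
  let ?v = "drop j w"
  have v: "?v \<in> spread_lists s (l - j) n" using Suc by blast
  show ?case
  proof (cases "l - j")
    case 0
    then show ?thesis using v by (simp add: drop_Suc flip: drop_tl)
  next
    case (Suc i)
    then obtain x b where "?v = x # b" "x \<le> n" "b \<in> spread_lists s i (x - s i)" using v by auto
    moreover from this have "drop (Suc j) w = b" by (metis drop_Suc drop_tl list.sel(3))
    moreover have "l - Suc j = i" using Suc by simp
    ultimately show ?thesis using spread_lists_mono[of b s i "x - s i" n] by simp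
  qed
qed simp

section \<open>Monomial ideals\<close>

text \<open>The polynomials all of whose monomials are divisible by some element of \<open>G\<close>
  form an ideal \<open>D\<close> containing the generators, hence the generated ideal.\<close>

lemma monomial_mem_genideal_iff:
  assumes G: "\<And>g. g \<in> G \<Longrightarrow> set_mset g \<subseteq> {1..n}" and u: "set_mset u \<subseteq> {1..n}"
  shows "(monomial u :: nat multiset \<Rightarrow>\<^sub>0 'k::field) \<in> genideal (poly_ring n) (monomial ` G)
    \<longleftrightarrow> (\<exists>g\<in>G. g \<subseteq># u)"
proof -
  let ?R = "poly_ring n :: (nat multiset \<Rightarrow>\<^sub>0 'k) ring"
  let ?M = "monomial :: nat multiset \<Rightarrow> (nat multiset \<Rightarrow>\<^sub>0 'k)"
  interpret cring ?R by (rule poly_ring_cring)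
  have carrier: "p \<in> carrier ?R \<longleftrightarrow> (\<forall>u\<in>Poly_Mapping.keys p. set_mset u \<subseteq> {1..n})" for p
    by (simp add: poly_ring_def)
  have ops: "p \<oplus>\<^bsub>?R\<^esub> q = p + q" "p \<otimes>\<^bsub>?R\<^esub> q = p * q" "\<zero>\<^bsub>?R\<^esub> = 0" for p q
    by (simp_all add: poly_ring_def)
  have keys_M: "Poly_Mapping.keys (?M v) = {v}" for v
    by (simp add: monomial_def)
  have M_carrier: "?M v \<in> carrier ?R" if "set_mset v \<subseteq> {1..n}" for v
    using that by (simp add: carrier keys_M)
  have sub: "?M ` G \<subseteq> carrier ?R" using G M_carrier by blast
  define D where "D = {p \<in> carrier ?R. \<forall>v\<in>Poly_Mapping.keys p. \<exists>g\<in>G. g \<subseteq># v}"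
  have mult_closed: "q * p \<in> D" if p: "p \<in> D" and q: "q \<in> carrier ?R" for p q
  proof -
    have "\<exists>g\<in>G. g \<subseteq># v" if v: "v \<in> Poly_Mapping.keys (q * p)" for v
    proof -
      obtain a b where "v = a + b" "b \<in> Poly_Mapping.keys p"
        using v keys_mult[of q p] by blast
      then show ?thesis
        using p subset_mset.order_trans[OF _ mset_subset_eq_add_right[of b a]] unfolding D_def by blast
    qed
    moreover have "q * p \<in> carrier ?R" using m_closed[OF q, of p] p by (simp add: ops D_def)
    ultimately show ?thesis by (simp add: D_def)
  qed
  have "ideal D ?R"
  proof (rule idealI[OF ring_axioms])
    show "subgroup D (add_monoid ?R)"
    proof (rule add.subgroupI)
      show "D \<subseteq> carrier ?R" by (auto simp: D_def)
      have "0 \<in> D" by (simp add: D_def carrier)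
      then show "D \<noteq> {}" by blast
      show "\<ominus>\<^bsub>?R\<^esub> p \<in> D" if "p \<in> D" for p
      proof -
        have p: "p \<in> carrier ?R" "- p \<in> carrier ?R" using that by (auto simp: D_def carrier)
        then have "\<ominus>\<^bsub>?R\<^esub> p = - p" by (intro minus_equality) (auto simp: ops)
        then show ?thesis using that p(2) by (simp add: D_def)
      qed
      show "p \<oplus>\<^bsub>?R\<^esub> q \<in> D" if "p \<in> D" "q \<in> D" for p q
      proof -
        have "p + q \<in> carrier ?R" using a_closed[of p q] that by (simp add: ops D_def)
        then show ?thesis using that keys_add[of p q] by (auto simp: ops D_def)
      qed
    qed
    show "q \<otimes>\<^bsub>?R\<^esub> p \<in> D" "p \<otimes>\<^bsub>?R\<^esub> q \<in> D" if "p \<in> D" "q \<in> carrier ?R" for p q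
      using mult_closed[OF that] by (simp_all add: ops mult.commute)
  qed
  moreover have "?M ` G \<subseteq> D" using sub by (auto simp: D_def keys_M)
  ultimately have gen_sub: "genideal ?R (?M ` G) \<subseteq> D" by (rule genideal_minimal)
  show ?thesis
  proof
    assume "?M u \<in> genideal ?R (?M ` G)"
    then show "\<exists>g\<in>G. g \<subseteq># u" using gen_sub by (auto simp: D_def keys_M)
  next
    assume "\<exists>g\<in>G. g \<subseteq># u"
    then obtain g where g: "g \<in> G" "g \<subseteq># u" by blast
    have "?M g \<in> genideal ?R (?M ` G)" using genideal_self[OF sub] g by blast
    moreover have "?M (u - g) \<in> carrier ?R"
      using u by (intro M_carrier) (meson in_diffD subset_iff)
    ultimately have "?M (u - g) \<otimes>\<^bsub>?R\<^esub> ?M g \<in> genideal ?R (?M ` G)"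
      by (rule ideal.I_l_closed[OF genideal_ideal[OF sub]])
    moreover have "?M (u - g) \<otimes>\<^bsub>?R\<^esub> ?M g = ?M u"
      using g(2) by (simp add: ops monomial_def mult_single)
    ultimately show "?M u \<in> genideal ?R (?M ` G)" by simp
  qed
qed

text \<open>The generators of \<open>I\<close> are spread monomials of degree at most
  \<open>d\<close>, so they already occur in the compared pieces. Applied both ways, this shows that
  the pieces determine the ideal.\<close>

lemma t_spread_ideal_mono:
  assumes I: "t_spread_ideal n d t I" and J: "t_spread_ideal n d t J"
    and sub: "\<And>l. l \<le> d \<Longrightarrow> list_part n t I l \<subseteq> list_part n t J l"
  shows "I \<subseteq> (J :: (nat multiset \<Rightarrow>\<^sub>0 'k::field) set)"
proof -
  let ?R = "poly_ring n :: (nat multiset \<Rightarrow>\<^sub>0 'k) ring"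
  interpret cring ?R by (rule poly_ring_cring)
  have carrier: "monomial ` G \<subseteq> carrier ?R" if "G \<subseteq> {u. t_spread n d t u}" for G
    using that by (force simp: poly_ring_def monomial_def t_spread_def)
  obtain G where G: "G \<subseteq> {u. t_spread n d t u}" "I = genideal ?R (monomial ` G)"
    using I by (auto simp: t_spread_ideal_def)
  obtain H where H: "H \<subseteq> {u. t_spread n d t u}" "J = genideal ?R (monomial ` H)"
    using J by (auto simp: t_spread_ideal_def)
  have "monomial g \<in> J" if "g \<in> G" for g
  proof -
    have "monomial g \<in> I" using genideal_self[OF carrier[OF G(1)]] G(2) that by blast
    moreover have spread: "t_spread n d t g" using G(1) that by blast
    ultimately have "g \<in> t_spread_part n d t I (size g)"
      by (simp add: t_spread_part_def t_spread_monomials_def)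
    moreover have "size g \<le> d" using spread by (simp add: t_spread_def)
    ultimately have "g \<in> mset ` list_part n t J (size g)"
      using sub[of "size g"] t_spread_part_eq_image[of "size g" d n t I] by blast
    then show ?thesis by (auto simp: list_part_def)
  qed
  then show ?thesis
    unfolding G(2) using genideal_ideal[OF carrier[OF H(1)]] H(2)
    by (intro genideal_minimal) auto
qed

text \<open>Prepending an entry multiplies the monomial by a variable.\<close>

lemma shadow_list_part:
  assumes "t_spread_ideal n d t I"
  shows "shadow (gap t) l n (list_part n t I l) \<subseteq> list_part n t I (Suc l)"
proof
  fix w assume "w \<in> shadow (gap t) l n (list_part n t I l)"
  then obtain x b where w: "w = x # b" "w \<in> spread_lists (gap t) (Suc l) n"
      "b \<in> list_part n t I l"
    by (auto simp: shadow_def)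
  obtain G where G: "G \<subseteq> {u. t_spread n d t u}" "I = genideal (poly_ring n) (monomial ` G)"
    using assms by (auto simp: t_spread_ideal_def)
  have mem: "monomial (mset v) \<in> I \<longleftrightarrow> (\<exists>g\<in>G. g \<subseteq># mset v)"
    if "v \<in> spread_lists (gap t) k n" for v k
    unfolding G(2) using that G(1)
    by (intro monomial_mem_genideal_iff) (auto simp: t_spread_def spread_lists_iff)
  have "b \<in> spread_lists (gap t) l n" "monomial (mset b) \<in> I" using w(3) by (auto simp: list_part_def)
  then obtain g where "g \<in> G" "g \<subseteq># mset b" using mem by blast
  moreover from this have "g \<subseteq># mset w"
    using w(1) by (metis mset.simps(2) mset_subset_eq_add_right add_mset_add_single mset_subset_eq_add_left subset_mset.order_trans)
  ultimately show "w \<in> list_part n t I (Suc l)"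
    using mem[OF w(2)] w(2) by (auto simp: list_part_def)
qed

text \<open>Being stable and closed under shadows, the sets \<open>Q l\<close> contain all spread
  multiples of their elements up to degree \<open>d\<close>, so generating an ideal adds no spread
  monomials there.\<close>

lemma list_part_genideal_lex_sets:
  fixes Q :: "nat \<Rightarrow> nat list set" and n d :: nat and t :: "nat list"
  assumes lex: "\<And>l. l \<le> d \<Longrightarrow> lex_set (gap t) l n (Q l)"
    and shadow: "\<And>l. Suc l \<le> d \<Longrightarrow> shadow (gap t) l n (Q l) \<subseteq> Q (Suc l)"
  defines "J \<equiv> genideal (poly_ring n) (monomial ` (\<Union>l\<le>d. mset ` Q l)) :: (nat multiset \<Rightarrow>\<^sub>0 'k::field) set"
  shows "t_spread_ideal n d t J" and "\<And>l. l \<le> d \<Longrightarrow> list_part n t J l = Q l"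
proof -
  let ?G = "\<Union>l\<le>d. mset ` Q l"
  have G: "?G \<subseteq> {u. t_spread n d t u}"
    using lex mset_spread_lists by (fastforce simp: lower_set_def t_spread_monomials_def)
  then show "t_spread_ideal n d t J"
    unfolding t_spread_ideal_def J_def by blast
  have mem: "monomial (mset v) \<in> J \<longleftrightarrow> (\<exists>g\<in>?G. g \<subseteq># mset v)"
    if "v \<in> spread_lists (gap t) k n" for v k
    unfolding J_def using that G
    by (intro monomial_mem_genideal_iff) (auto simp: t_spread_def spread_lists_iff)
  \<comment> \<open>Restores the \<open>j\<close> dropped largest entries one at a time, each by
    closure under shadows.\<close>
  have extend: "w \<in> Q l"
    if "w \<in> spread_lists (gap t) l n" "l \<le> d" "drop j w \<in> Q (l - j)" "j \<le> l" for w l j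
    using that
  proof (induction j arbitrary: w l)
    case (Suc j)
    then obtain i where l: "l = Suc i" by (cases l) auto
    obtain x b where w: "w = x # b" "1 \<le> x" "x \<le> n" "b \<in> spread_lists (gap t) i (x - gap t i)"
      using Suc.prems(1) l by auto
    have "b \<in> spread_lists (gap t) i n" by (rule spread_lists_mono[OF w(4)]) (use w in simp)
    then have "b \<in> Q i" using Suc.IH[of b i] Suc.prems w l by simp
    then have "w \<in> shadow (gap t) i n (Q i)" using w by (auto simp: shadow_def)
    then show ?case using shadow[of i] Suc.prems(2) l by blast
  qed simp
  show "list_part n t J l = Q l" if l: "l \<le> d" for l
  proof
    show "Q l \<subseteq> list_part n t J l"
      using lex[OF l] mem l by (fastforce simp: list_part_def lower_set_def)
    show "list_part n t J l \<subseteq> Q l"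
    proof
      fix w assume "w \<in> list_part n t J l"
      then have w: "w \<in> spread_lists (gap t) l n" "monomial (mset w) \<in> J"
        by (auto simp: list_part_def)
      then obtain k g where g: "k \<le> d" "g \<in> Q k" "mset g \<subseteq># mset w" using mem by blast
      then have g_spread: "g \<in> spread_lists (gap t) k n" using lex by (auto simp: lower_set_def)
      have len: "length w = l" "length g = k" using w g_spread length_spread_lists by blast+
      then have "k \<le> l" using size_mset_mono[OF g(3)] by simp
      \<comment> \<open>The \<open>k\<close> smallest entries of the multiple lie below the divisor
        \<open>g\<close>, so stability puts them in \<open>Q k\<close>.\<close>
      have "list_all2 (\<le>) (drop (l - k) w) g"
        using drop_le_of_subseteq_mset[OF _ _ g(3)] w g_spread len by (simp add: spread_lists_iff)
      moreover have "drop (l - k) w \<in> spread_lists (gap t) k n"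
        using drop_spread_lists[OF w(1), of "l - k"] \<open>k \<le> l\<close> by simp
      ultimately have "drop (l - k) w \<in> Q k"
        using lower_setD[OF lex_set_imp_stable_set[OF lex[OF g(1)]] g(2)] by blast
      then show "w \<in> Q l" using extend[OF w(1) l, of "l - k"] \<open>k \<le> l\<close> by simp
    qed
  qed
qed

section \<open>Existence and uniqueness of the lex ideal\<close>

lemma t_spread_lex_ideal_iff:
  "t_spread_lex_ideal n d t J \<longleftrightarrow>
    t_spread_ideal n d t J \<and> (\<forall>l\<le>d. lex_set (gap t) l n (list_part n t J l))"
proof -
  have "t_spread_lex_set n d t l (t_spread_part n d t J l)" if "\<not> l \<le> d" for l
    using that by (simp add: t_spread_part_empty t_spread_lex_set_def)
  then show ?thesis
    unfolding t_spread_lex_ideal_def using t_spread_lex_set_iff by blast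
qed

theorem proposition3p6:
  fixes n d :: nat and t :: "nat list" and I :: "(nat multiset \<Rightarrow>\<^sub>0 'k::field) set"
  assumes "d \<ge> 2" and "length t = d - 1"
    and "t_spread_strongly_stable_ideal n d t I"
  shows "\<exists>!J :: (nat multiset \<Rightarrow>\<^sub>0 'k) set.
           t_spread_lex_ideal n d t J \<and> f_vector n d t I = f_vector n d t J"
proof -
  let ?P = "list_part n t I" and ?S = "\<lambda>l. spread_lists (gap t) l n"
  have I: "t_spread_ideal n d t I"
    and stable: "\<And>l. l \<le> d \<Longrightarrow> stable_set (gap t) l n (?P l)"
    using assms(3) stable_set_list_part unfolding t_spread_strongly_stable_ideal_def by blast+
  have "card (?P l) \<le> card (?S l)" for l
    by (intro card_mono finite_spread_lists list_part_subset)
  then have "\<exists>A. lex_set (gap t) l n A \<and> card A = card (?P l)" for l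
    using ex_lex_set_card by blast
  then obtain Q where Q: "\<And>l. lex_set (gap t) l n (Q l)" "\<And>l. card (Q l) = card (?P l)"
    by metis
  have "shadow (gap t) l n (Q l) \<subseteq> Q (Suc l)" if "Suc l \<le> d" for l
  proof (rule lex_set_subset[OF lex_set_shadow[OF Q(1)] Q(1)])
    have P: "stable_set (gap t) l n (?P l)" using stable that by simp
    \<comment> \<open>The lex set minimises every summand of the shadow size, and the shadow of
      \<open>?P l\<close> fits into \<open>?P (Suc l)\<close> because \<open>I\<close> is an
      ideal.\<close>
    have "card (shadow (gap t) l n (Q l)) \<le> card (shadow (gap t) l n (?P l))"
      unfolding card_shadow[OF finite_lower_set[OF Q(1)]] card_shadow[OF finite_lower_set[OF P]]
      by (intro sum_mono lex_set_card_le_stable_set[OF P Q(1)]) (simp add: Q(2))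
    also have "\<dots> \<le> card (?P (Suc l))"
      by (intro card_mono shadow_list_part[OF I]
          finite_subset[OF list_part_subset finite_spread_lists])
    finally show "card (shadow (gap t) l n (Q l)) \<le> card (Q (Suc l))" by (simp add: Q(2))
  qed simp
  note J = list_part_genideal_lex_sets[of d t n Q, OF Q(1) this]
  show ?thesis
  proof (rule ex_ex1I)
    show "\<exists>J. t_spread_lex_ideal n d t J \<and> f_vector n d t I = f_vector n d t J"
      using J Q unfolding t_spread_lex_ideal_iff f_vector_eq_iff by metis
    fix J J' :: "(nat multiset \<Rightarrow>\<^sub>0 'k) set"
    assume J: "t_spread_lex_ideal n d t J \<and> f_vector n d t I = f_vector n d t J"
      and J': "t_spread_lex_ideal n d t J' \<and> f_vector n d t I = f_vector n d t J'"
    \<comment> \<open>Equal \<open>f_vector\<close>s give lex sets of equal size in each degree, and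
      these coincide.\<close>
    have "list_part n t J l = list_part n t J' l" if "l \<le> d" for l
    proof -
      have "lex_set (gap t) l n (list_part n t J l)" "lex_set (gap t) l n (list_part n t J' l)"
        "card (list_part n t J l) = card (list_part n t J' l)"
        using J J' that unfolding t_spread_lex_ideal_iff f_vector_eq_iff by simp_all
      then show ?thesis using lex_set_subset by (metis order_refl subset_antisym)
    qed
    moreover have "t_spread_ideal n d t J" "t_spread_ideal n d t J'"
      using J J' unfolding t_spread_lex_ideal_iff by simp_all
    ultimately show "J = J'"
      by (intro subset_antisym; intro t_spread_ideal_mono[of n d t]) simp_all
  qed
qed

end
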